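(* Consider a Petri net with free choice and priority routing. (i) Suppose $(m,w,f)$ is a stationary solution of the continuous dynamics. Then, for the initial marking $M^0_p=m_p$ ($p\in\mathcal P$), setting $\rho_q=f_q$ for $q\in\mathcal Q$, $\rho_p=f_p=m_p/\tau_p$ for $p\in\mathcal P$, $u_p=M^0_p$ for $p\in\mathcal P$ and $u_q=0$ for $q\in\mathcal Q$ yields a stationary solution $(\rho,u)$ of the discrete dynamics. (ii) Conversely, suppose $(\rho,u)$ is a stationary solution of the discrete dynamics (for some initial marking $M^0$). Define $f_q=\rho_q$ for every transition $q$ and $m_p=\rho_p\tau_p$ for every place $p$. Then there is a policy $\pi^*$ with $(S_{\pi^*}C^+-C^-_{\pi^*})f=0$ for which one can define a vector $w$ of affine functions $w_p:\mathbb R_{\ge0}\to\mathbb R_{\ge0}$ satisfying $\dot w=\frac m\tau-C^-f$ and $S_{\pi^*}w(t)=0$ for all $t$, and for any such $w$ the triple $(m,w,f)$ is a stationary solution of the continuous dynamics.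
   Context: Net. A Petri net consists of a finite set $\mathcal P$ of places, a finite set $\mathcal Q$ of transitions, and valuations $a^+_{qp}\in\mathbb N$ of the arc from transition $q$ to place $p$ and $a^-_{qp}\in\mathbb N$ of the arc from place $p$ to transition $q$ (value $0$ meaning no arc). The net is pure: for each $(q,p)$ at least one of $a^+_{qp},a^-_{qp}$ is $0$. $C^+,C^-$ are the $\mathcal P\times\mathcal Q$ matrices with $(p,q)$ entries $a^+_{qp}$, $a^-_{qp}$. Write $q^{\mathrm{in}}=\{p: a^-_{qp}>0\}$, $p^{\mathrm{in}}=\{q:a^+_{qp}>0\}$ and $p^{\mathrm{out}}=\{q:a^-_{qp}>0\}$. The net is strongly connected and autonomous; in particular each transition has at least one upstream place. Every place is either free choice (either $q^{\mathrm{in}}=\{p\}$ for all $q\in p^{\mathrm{out}}$, or $|p^{\mathrm{out}}|=1$) or subject to priority. $\mathcal P_{\mathsf{conflict}}$ is the set of free choice places with at least two output transitions; $\mathcal P_{\mathsf{priority}}$ is the set of places subject to priority; $\mathcal Q_{\mathsf{sync}}$ is the set of transitions all of whose upstream places $p$ are free choice with $|p^{\mathrm{out}}|=1$. Each $p\in\mathcal P_{\mathsf{priority}}$ has exactly two output transitions, $q_+=q_+(p)$ (with priority) and $q_-=q_-(p)$; each transition has at most one upstream place in $\mathcal P_{\mathsf{priority}}$. Each place has a time $\tau_p>0$, and for $p\in\mathcal P_{\mathsf{conflict}}$, $q\in p^{\mathrm{out}}$ there are weights $\mu_{qp}>0$ with $\sum_{q\in p^{\mathrm{out}}}\mu_{qp}=1$.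 Denote by $m/\tau$ the vector $(m_p/\tau_p)_{p\in\mathcal P}$. A minimum over the empty set is $+\infty$. Continuous dynamics. It consists, for nonnegative functions $(m,w,f)$ of $t\ge0$ with values in $\mathbb R^{\mathcal P},\mathbb R^{\mathcal P},\mathbb R^{\mathcal Q}$, of the equations $\dot m(t)=C^+f(t)-m(t)/\tau$, $\dot w(t)=m(t)/\tau-C^-f(t)$, together with the requirements that at every $t$ each transition $q$ has an upstream place $p$ with $w_p(t)=0$, and - for $q\in\mathcal Q_{\mathsf{sync}}$: $f_q(t)=\min_{p\in q^{\mathrm{in}},w_p(t)=0}\frac{m_p(t)}{a^-_{qp}\tau_p}$; - for $p\in\mathcal P_{\mathsf{conflict}}$, $q\in p^{\mathrm{out}}$: $a^-_{qp}f_q(t)=\mu_{qp}\frac{m_p(t)}{\tau_p}$; - for $p\in\mathcal P_{\mathsf{priority}}$: $f_{q_+}(t)=\min_{r\in q_+^{\mathrm{in}},w_r(t)=0}\frac{m_r(t)}{a^-_{q_+r}\tau_r}$, and $f_{q_-}(t)=\min_{r\in q_-^{\mathrm{in}}\setminus\{p\},w_r(t)=0}\frac{m_r(t)}{a^-_{q_-r}\tau_r}$ if $w_p(t)\ne0$, while if $w_p(t)=0$, $f_{q_-}(t)=\min\Big(\frac{m_p(t)}{a^-_{q_-p}\tau_p}-\frac{a^-_{q_+p}}{a^-_{q_-p}}f_{q_+}(t),\ \min_{r\in q_-^{\mathrm{in}}\setminus\{p\},w_r(t)=0}\frac{m_r(t)}{a^-_{q_-r}\tau_r}\Big)$. A stationary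 solution of the continuous dynamics is a solution $(m,w,f)$ on $[0,\infty)$ such that every $m_p$ is constant and every $w_p$ is affine; $f$ is then constant in time and $m$, $f$ are identified with their values. Policies. A policy $\pi$ maps each transition $q$ to one of its upstream places $p_\pi(q)\in q^{\mathrm{in}}$. $S_\pi$ is the $\mathcal Q\times\mathcal P$ matrix with $(S_\pi)_{qp}=1$ if $p=p_\pi(q)$ and $0$ otherwise. $C^-_\pi$ is the $\mathcal Q\times\mathcal Q$ matrix such that, with $p=p_\pi(q)$: $(C^-_\pi f)_q=a^-_{qp}f_q$ if $p\notin\mathcal P_{\mathsf{conflict}}\cup\mathcal P_{\mathsf{priority}}$; $(C^-_\pi f)_q=\frac{a^-_{qp}}{\mu_{qp}}f_q$ if $p\in\mathcal P_{\mathsf{conflict}}$; $(C^-_\pi f)_q=a^-_{qp}f_q$ if $p\in\mathcal P_{\mathsf{priority}}$ and $q=q_+(p)$; $(C^-_\pi f)_q=a^-_{qp}f_q+a^-_{q_+p}f_{q_+}$ if $p\in\mathcal P_{\mathsf{priority}}$, $q=q_-(p)$ and $q_+=q_+(p)$. Stationary solutions of the discrete dynamics. Given an initial marking $M^0\in\mathbb R_{\ge0}^{\mathcal P}$ (fluid setting), a stationary solution of the (fluid) discrete dynamics, corresponding to counter functions that are ultimately affine, $x_p(t)=u_p+t\rho_p$ and $z_q(t)=u_q+t\rho_q$, is a pair $(\rho,u)$ with $\rho\in\mathbb R_{\ge0}^{\mathcal P\sqcup\mathcal Q}$, $u\in\mathbb R^{\mathcal P\sqcup\mathcal Q}$ satisfying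 the following system. Throughputs: - $\rho_p=\sum_{q\in p^{\mathrm{in}}}a^+_{qp}\rho_q$ for $p\in\mathcal P$; - $\rho_q=\mu_{qp}\rho_p/a^-_{qp}$ for $p\in\mathcal P_{\mathsf{conflict}}$, $q\in p^{\mathrm{out}}$; - $\rho_q=\min_{p\in q^{\mathrm{in}}}\rho_p/a^-_{qp}$ for $q\in\mathcal Q_{\mathsf{sync}}$; - for $p\in\mathcal P_{\mathsf{priority}}$: $\rho_{q_+}=\min_{r\in q_+^{\mathrm{in}}}\rho_r/a^-_{q_+r}$ and $\rho_{q_-}=\min\big((\rho_p-a^-_{q_+p}\rho_{q_+})/a^-_{q_-p},\ \min_{r\in q_-^{\mathrm{in}}\setminus\{p\}}\rho_r/a^-_{q_-r}\big)$. Constants: - $u_p=M^0_p+\sum_{q\in p^{\mathrm{in}}}a^+_{qp}u_q$ for $p\in\mathcal P$; - $u_q=(\mu_{qp}/a^-_{qp})(u_p-\rho_p\tau_p)$ for $p\in\mathcal P_{\mathsf{conflict}}$, $q\in p^{\mathrm{out}}$; - $u_q=\min_{p\in q^{\mathrm{in}},\,a^-_{qp}\rho_q=\rho_p}(u_p-\rho_p\tau_p)/a^-_{qp}$ for $q\in\mathcal Q_{\mathsf{sync}}$; - for $p\in\mathcal P_{\mathsf{priority}}$, with $B_\pm=\min_{r\in q_\pm^{\mathrm{in}}\setminus\{p\},\,a^-_{q_\pm r}\rho_{q_\pm}=\rho_r}(u_r-\rho_r\tau_r)/a^-_{q_\pm r}$: $u_{q_+}=\min\big((u_p-\rho_p\tau_p-a^-_{q_-p}u_{q_-})/a^-_{q_+p},\,B_+\big)$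 if $\rho_{q_-}=0$, and $u_{q_+}=B_+$ otherwise; $u_{q_-}=\min\big((u_p-\rho_p\tau_p-a^-_{q_+p}u_{q_+})/a^-_{q_-p},\,B_-\big)$ if $a^-_{q_-p}\rho_{q_-}+a^-_{q_+p}\rho_{q_+}=\rho_p$, and $u_{q_-}=B_-$ otherwise. *)

theory Defs
  imports "HOL-Analysis.Analysis"
begin

text \<open>Places and transitions are the elements of two finite types.
  \<open>a_plus N q p\<close> is the valuation of the arc from transition \<open>q\<close> to place \<open>p\<close>,
  \<open>a_minus N q p\<close> that of the arc from place \<open>p\<close> to transition \<open>q\<close> (0 = no arc).
  \<open>weight N q p\<close>, and \<open>q_plus N p\<close>, \<open>q_minus N p\<close>, are only meaningful when \<open>p\<close> is a
  conflict place with output \<open>q\<close>, respectively a priority place.\<close>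

record ('p, 'q) petri_net =
  a_plus :: "'q \<Rightarrow> 'p \<Rightarrow> nat"
  a_minus :: "'q \<Rightarrow> 'p \<Rightarrow> nat"
  hold :: "'p \<Rightarrow> real"
  weight :: "'q \<Rightarrow> 'p \<Rightarrow> real"
  P_priority :: "'p set"
  q_plus :: "'p \<Rightarrow> 'q"
  q_minus :: "'p \<Rightarrow> 'q"

definition q_in :: "('p, 'q) petri_net \<Rightarrow> 'q \<Rightarrow> 'p set" where
  "q_in N q = {p. a_minus N q p > 0}"

definition p_in :: "('p, 'q) petri_net \<Rightarrow> 'p \<Rightarrow> 'q set" where
  "p_in N p = {q. a_plus N q p > 0}"

definition p_out :: "('p, 'q) petri_net \<Rightarrow> 'p \<Rightarrow> 'q set" where
  "p_out N p = {q. a_minus N q p > 0}"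

definition arcs :: "('p, 'q) petri_net \<Rightarrow> (('p + 'q) \<times> ('p + 'q)) set" where
  "arcs N = {(Inl p, Inr q) | p q. a_minus N q p > 0}
          \<union> {(Inr q, Inl p) | p q. a_plus N q p > 0}"

definition free_choice :: "('p, 'q) petri_net \<Rightarrow> 'p \<Rightarrow> bool" where
  "free_choice N p \<longleftrightarrow> (\<forall>q\<in>p_out N p. q_in N q = {p}) \<or> card (p_out N p) = 1"

text \<open>A place subject to priority might happen to satisfy the structural free choice
  condition; it is then still routed by priority, hence the exclusion below.\<close>

definition P_conflict :: "('p, 'q) petri_net \<Rightarrow> 'p set" where
  "P_conflict N = {p. p \<notin> P_priority N \<and> free_choice N p \<and> card (p_out N p) \<ge> 2}"

definition Q_sync :: "('p, 'q) petri_net \<Rightarrow> 'q set" where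
  "Q_sync N = {q. \<forall>p\<in>q_in N q. free_choice N p \<and> card (p_out N p) = 1}"

definition free_choice_priority_net :: "('p::finite, 'q::finite) petri_net \<Rightarrow> bool" where
  "free_choice_priority_net N \<longleftrightarrow>
     (\<forall>q p. a_plus N q p = 0 \<or> a_minus N q p = 0) \<and>
     (\<forall>x y. (x, y) \<in> (arcs N)\<^sup>*) \<and>
     (\<forall>q. q_in N q \<noteq> {}) \<and>
     (\<forall>p. free_choice N p \<or> p \<in> P_priority N) \<and>
     (\<forall>p\<in>P_priority N. q_plus N p \<noteq> q_minus N p \<and> p_out N p = {q_plus N p, q_minus N p}) \<and>
     (\<forall>q. card (q_in N q \<inter> P_priority N) \<le> 1) \<and>
     (\<forall>p. hold N p > 0) \<and>
     (\<forall>p\<in>P_conflict N. (\<forall>q\<in>p_out N p. weight N q p > 0) \<and> (\<Sum>q\<in>p_out N p. weight N q p) = 1)"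

definition C_plus :: "('p::finite, 'q::finite) petri_net \<Rightarrow> real^'q^'p" where
  "C_plus N = (\<chi> p q. real (a_plus N q p))"

definition C_minus :: "('p::finite, 'q::finite) petri_net \<Rightarrow> real^'q^'p" where
  "C_minus N = (\<chi> p q. real (a_minus N q p))"

definition over_hold :: "('p::finite, 'q) petri_net \<Rightarrow> real^'p \<Rightarrow> real^'p" where
  "over_hold N m = (\<chi> p. m $ p / hold N p)"

text \<open>Minima are rendered as infima in the extended reals, so that the minimum over the
  empty set is \<open>\<infinity>\<close>; all index sets are finite.\<close>

definition continuous_solution ::
  "('p::finite, 'q::finite) petri_net \<Rightarrow> (real \<Rightarrow> real^'p) \<Rightarrow> (real \<Rightarrow> real^'p) \<Rightarrow> (real \<Rightarrow> real^'q) \<Rightarrow> bool"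
where
  "continuous_solution N m w f \<longleftrightarrow> (\<forall>t\<ge>0.
     (\<forall>p. m t $ p \<ge> 0) \<and> (\<forall>p. w t $ p \<ge> 0) \<and> (\<forall>q. f t $ q \<ge> 0) \<and>
     (m has_vector_derivative (C_plus N *v f t - over_hold N (m t))) (at t within {0..}) \<and>
     (w has_vector_derivative (over_hold N (m t) - C_minus N *v f t)) (at t within {0..}) \<and>
     (\<forall>q. \<exists>p\<in>q_in N q. w t $ p = 0) \<and>
     (\<forall>q\<in>Q_sync N. ereal (f t $ q) =
        (INF p\<in>{p \<in> q_in N q. w t $ p = 0}. ereal (m t $ p / (a_minus N q p * hold N p)))) \<and>
     (\<forall>p\<in>P_conflict N. \<forall>q\<in>p_out N p.
        a_minus N q p * f t $ q = weight N q p * (m t $ p / hold N p)) \<and>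
     (\<forall>p\<in>P_priority N. let qp = q_plus N p; qm = q_minus N p;
          others = (INF r\<in>{r \<in> q_in N qm - {p}. w t $ r = 0}.
                      ereal (m t $ r / (a_minus N qm r * hold N r)))
        in ereal (f t $ qp) =
             (INF r\<in>{r \<in> q_in N qp. w t $ r = 0}. ereal (m t $ r / (a_minus N qp r * hold N r))) \<and>
           (w t $ p \<noteq> 0 \<longrightarrow> ereal (f t $ qm) = others) \<and>
           (w t $ p = 0 \<longrightarrow> ereal (f t $ qm) =
             min (ereal (m t $ p / (a_minus N qm p * hold N p)
                         - a_minus N qp p / a_minus N qm p * f t $ qp)) others)))"

definition stationary_continuous ::
  "('p::finite, 'q::finite) petri_net \<Rightarrow> (real \<Rightarrow> real^'p) \<Rightarrow> (real \<Rightarrow> real^'p) \<Rightarrow> (real \<Rightarrow> real^'q) \<Rightarrow> bool"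
where
  "stationary_continuous N m w f \<longleftrightarrow> continuous_solution N m w f \<and>
     (\<forall>p. \<exists>c. \<forall>t\<ge>0. m t $ p = c) \<and>
     (\<forall>p. \<exists>b c. \<forall>t\<ge>0. w t $ p = b + t * c)"

definition is_policy :: "('p, 'q) petri_net \<Rightarrow> ('q \<Rightarrow> 'p) \<Rightarrow> bool" where
  "is_policy N \<pi> \<longleftrightarrow> (\<forall>q. \<pi> q \<in> q_in N q)"

definition S_policy :: "('q::finite \<Rightarrow> 'p::finite) \<Rightarrow> real^'p^'q" where
  "S_policy \<pi> = (\<chi> q p. if p = \<pi> q then 1 else 0)"

definition C_policy :: "('p::finite, 'q::finite) petri_net \<Rightarrow> ('q \<Rightarrow> 'p) \<Rightarrow> real^'q^'q" where
  "C_policy N \<pi> = (\<chi> q q'. let p = \<pi> q in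
     if q' = q then (if p \<in> P_conflict N then a_minus N q p / weight N q p else a_minus N q p)
     else if p \<in> P_priority N \<and> q = q_minus N p \<and> q' = q_plus N p then real (a_minus N q' p)
     else 0)"

definition affine_backlog ::
  "('p::finite, 'q::finite) petri_net \<Rightarrow> ('q \<Rightarrow> 'p) \<Rightarrow> real^'p \<Rightarrow> real^'q \<Rightarrow> (real \<Rightarrow> real^'p) \<Rightarrow> bool"
where
  "affine_backlog N \<pi> m f w \<longleftrightarrow>
     (\<forall>p. \<exists>b c. \<forall>t\<ge>0. w t $ p = b + t * c) \<and>
     (\<forall>t\<ge>0. (\<forall>p. w t $ p \<ge> 0) \<and>
        (w has_vector_derivative (over_hold N m - C_minus N *v f)) (at t within {0..}) \<and>
        S_policy \<pi> *v w t = 0)"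

text \<open>For \<open>\<rho>\<close> and \<open>u\<close>, the component of a place \<open>p\<close> is \<open>Inl p\<close> and that of a
  transition \<open>q\<close> is \<open>Inr q\<close>.\<close>

definition throughput_eqs ::
  "('p::finite, 'q::finite) petri_net \<Rightarrow> real^('p + 'q) \<Rightarrow> bool"
where
  "throughput_eqs N \<rho> \<longleftrightarrow>
     (\<forall>p. \<rho> $ Inl p = (\<Sum>q\<in>p_in N p. a_plus N q p * \<rho> $ Inr q)) \<and>
     (\<forall>p\<in>P_conflict N. \<forall>q\<in>p_out N p. \<rho> $ Inr q = weight N q p * \<rho> $ Inl p / a_minus N q p) \<and>
     (\<forall>q\<in>Q_sync N. ereal (\<rho> $ Inr q) = (INF p\<in>q_in N q. ereal (\<rho> $ Inl p / a_minus N q p))) \<and>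
     (\<forall>p\<in>P_priority N. let qp = q_plus N p; qm = q_minus N p in
        ereal (\<rho> $ Inr qp) = (INF r\<in>q_in N qp. ereal (\<rho> $ Inl r / a_minus N qp r)) \<and>
        ereal (\<rho> $ Inr qm) =
          min (ereal ((\<rho> $ Inl p - a_minus N qp p * \<rho> $ Inr qp) / a_minus N qm p))
              (INF r\<in>q_in N qm - {p}. ereal (\<rho> $ Inl r / a_minus N qm r)))"

definition constant_eqs ::
  "('p::finite, 'q::finite) petri_net \<Rightarrow> real^'p \<Rightarrow> real^('p + 'q) \<Rightarrow> real^('p + 'q) \<Rightarrow> bool"
where
  "constant_eqs N M0 \<rho> u \<longleftrightarrow>
     (\<forall>p. u $ Inl p = M0 $ p + (\<Sum>q\<in>p_in N p. a_plus N q p * u $ Inr q)) \<and>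
     (\<forall>p\<in>P_conflict N. \<forall>q\<in>p_out N p.
        u $ Inr q = weight N q p / a_minus N q p * (u $ Inl p - \<rho> $ Inl p * hold N p)) \<and>
     (\<forall>q\<in>Q_sync N. ereal (u $ Inr q) =
        (INF p\<in>{p \<in> q_in N q. a_minus N q p * \<rho> $ Inr q = \<rho> $ Inl p}.
           ereal ((u $ Inl p - \<rho> $ Inl p * hold N p) / a_minus N q p))) \<and>
     (\<forall>p\<in>P_priority N. let qp = q_plus N p; qm = q_minus N p;
          B = (\<lambda>q. INF r\<in>{r \<in> q_in N q - {p}. a_minus N q r * \<rho> $ Inr q = \<rho> $ Inl r}.
                 ereal ((u $ Inl r - \<rho> $ Inl r * hold N r) / a_minus N q r))
        in ereal (u $ Inr qp) =
             (if \<rho> $ Inr qm = 0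
              then min (ereal ((u $ Inl p - \<rho> $ Inl p * hold N p - a_minus N qm p * u $ Inr qm)
                               / a_minus N qp p)) (B qp)
              else B qp) \<and>
           ereal (u $ Inr qm) =
             (if a_minus N qm p * \<rho> $ Inr qm + a_minus N qp p * \<rho> $ Inr qp = \<rho> $ Inl p
              then min (ereal ((u $ Inl p - \<rho> $ Inl p * hold N p - a_minus N qp p * u $ Inr qp)
                               / a_minus N qm p)) (B qm)
              else B qm))"

definition stationary_discrete ::
  "('p::finite, 'q::finite) petri_net \<Rightarrow> real^'p \<Rightarrow> real^('p + 'q) \<Rightarrow> real^('p + 'q) \<Rightarrow> bool"
where
  "stationary_discrete N M0 \<rho> u \<longleftrightarrow>
     (\<forall>p. M0 $ p \<ge> 0) \<and> (\<forall>i. \<rho> $ i \<ge> 0) \<and> throughput_eqs N \<rho> \<and> constant_eqs N M0 \<rho> u"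

end

theory Submission
  imports Defs
begin

text \<open>
  Both kinds of stationary solutions carry the same information: the rates \<open>r\<close> at which tokens
  leave the holding phase of the places and the rates \<open>f\<close> of the transitions. These rates form an
  \<^emph>\<open>equilibrium\<close>, a notion that mentions neither time nor minima. Two conditions define it. The
  rates are \<^emph>\<open>balanced\<close>: each place receives what it passes on, a place is asked for at most what it
  passes on, and the conflict places split their flow by weight. And each transition has a
  \<^emph>\<open>bottleneck\<close>: an upstream place whose flow is consumed completely and, if the transition is
  the one with priority there, by that transition alone.

  The minima in the two dynamics translate into this notion as follows. Balance bounds the rate
  of a transition by the term of each upstream place, and the term of a bottleneck attains the
  bound. So the minimum equations hold over every set of upstream places that contains a
  bottleneck: over all of them, as in the throughput equations, or over those without backlog, as
  in the continuous dynamics (\<open>equilibrium_rate_sync\<close>, \<open>equilibrium_rate_plus\<close>,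
  \<open>equilibrium_rate_minus\<close>, \<open>equilibrium_rate_minus_idle\<close>).

  Conversely, both dynamics yield an equilibrium. In the continuous dynamics, an affine
  backlog that stays nonnegative has a nonnegative slope, and this slope is the unused flow of the
  place; a place whose backlog vanishes at a positive time has slope zero, so its flow is consumed
  completely (\<open>stationary_continuous_imp_equilibrium\<close>). In the discrete dynamics, balance and
  bottlenecks are read off from the minima in the throughput equations
  (\<open>throughput_eqs_imp_equilibrium\<close>).

  For the first part it remains to see that the constants \<open>u = m\<close> on places and \<open>u = 0\<close> on
  transitions solve their equations: every term of every minimum is then \<open>0\<close>, and bottlenecks make
  the relevant index sets nonempty (\<open>equilibrium_imp_stationary_discrete\<close>). For the second part,
  the policy selects a bottleneck of each transition. The unused flow accumulates in backlogs that
  grow linearly from \<open>0\<close> and vanish at the bottlenecks, and every backlog that vanishes there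
  satisfies the continuous dynamics (\<open>affine_backlog_imp_stationary_continuous\<close>).
\<close>

section \<open>Minima and affine functions\<close>

text \<open>A real number can only be the minimum of a nonempty set, because the empty minimum is \<open>\<infinity>\<close>.
  Hence every minimum equation for a rate also provides a place where the minimum is attained.\<close>
lemma ereal_eq_INF_iff:
  fixes g :: "'a \<Rightarrow> real"
  assumes "finite A"
  shows "ereal v = (INF x\<in>A. ereal (g x)) \<longleftrightarrow> (\<exists>x\<in>A. g x = v) \<and> (\<forall>x\<in>A. v \<le> g x)"
proof (cases "A = {}")
  case False
  have "(INF x\<in>A. ereal (g x)) = Min ((\<lambda>x. ereal (g x)) ` A)"
    using assms False by (simp add: Min_Inf)
  moreover have "ereal v = Min ((\<lambda>x. ereal (g x)) ` A) \<longleftrightarrow>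
      (\<exists>x\<in>A. g x = v) \<and> (\<forall>x\<in>A. v \<le> g x)"
    using assms False by (subst eq_Min_iff) auto
  ultimately show ?thesis by simp
qed (simp add: top_ereal_def)

text \<open>The one-sided derivative at \<open>0\<close> is included: \<open>0\<close> is a limit point of \<open>{0..}\<close>, so the derivative
  is unique there too.\<close>
lemma affine_slope_unique:
  fixes w :: "real \<Rightarrow> real^'p"
  assumes "(w has_vector_derivative D) (at t within {0..})" "t \<ge> 0"
    and "\<forall>s\<ge>0. w s $ p = b + s * c"
  shows "D $ p = c"
proof -
  have "((\<lambda>s. w s $ p) has_vector_derivative D $ p) (at t within {0..})"
    using bounded_linear.has_vector_derivative[OF bounded_linear_vec_nth assms(1)] .
  moreover have "((\<lambda>s. w s $ p) has_vector_derivative c) (at t within {0..})"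
  proof (rule has_vector_derivative_transform[where f = "\<lambda>s. b + s * c"])
    show "((\<lambda>s. b + s * c) has_vector_derivative c) (at t within {0..})"
      unfolding has_real_derivative_iff_has_vector_derivative[symmetric]
      by (auto intro!: derivative_eq_intros)
  qed (use assms in auto)
  moreover have "at t within {0..} \<noteq> bot"
  proof -
    have "at_right t \<le> at t within {0..}" using assms(2) by (intro at_le) auto
    then show ?thesis using trivial_limit_at_right_real[of t] by (auto simp: bot_unique)
  qed
  ultimately show ?thesis
    by (rule vector_derivative_unique_within[rotated])
qed

section \<open>Arcs, production and consumption\<close>

lemma mem_p_out_iff: "q \<in> p_out N p \<longleftrightarrow> p \<in> q_in N q"
  by (simp add: p_out_def q_in_def)

lemma a_minus_pos: "p \<in> q_in N q \<Longrightarrow> a_minus N q p > 0"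
  by (simp add: q_in_def)

lemma a_minus_divide_eq:
  fixes x y :: real
  shows "p \<in> q_in N q \<Longrightarrow> x / a_minus N q p = y \<longleftrightarrow> a_minus N q p * y = x"
  using a_minus_pos[of p N q] by (auto simp: field_simps)

lemma conflict_not_priority: "p \<in> P_conflict N \<Longrightarrow> p \<notin> P_priority N"
  by (simp add: P_conflict_def)

lemma conflict_sole_upstream:
  "p \<in> P_conflict N \<Longrightarrow> p \<in> q_in N q \<Longrightarrow> q_in N q = {p}"
  by (auto simp: P_conflict_def free_choice_def mem_p_out_iff)

lemma consumption_sum: "(C_minus N *v f) $ p = (\<Sum>q\<in>p_out N p. a_minus N q p * f $ q)"
  unfolding matrix_vector_mult_def C_minus_def
  by (simp, rule sum.mono_neutral_right) (auto simp: p_out_def)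

lemma production_sum: "(C_plus N *v f) $ p = (\<Sum>q\<in>p_in N p. a_plus N q p * f $ q)"
  unfolding matrix_vector_mult_def C_plus_def
  by (simp, rule sum.mono_neutral_right) (auto simp: p_in_def)

lemma consumption_single: "p_out N p = {q} \<Longrightarrow> (C_minus N *v f) $ p = a_minus N q p * f $ q"
  by (simp add: consumption_sum)

lemma consumption_ge:
  assumes "\<forall>q. 0 \<le> f $ q" "p \<in> q_in N q"
  shows "a_minus N q p * f $ q \<le> (C_minus N *v f) $ p"
  unfolding consumption_sum
  by (rule member_le_sum) (use assms in \<open>auto simp: mem_p_out_iff\<close>)

lemma S_policy_mult: "(S_policy \<pi> *v x) $ q = x $ \<pi> q"
  by (simp add: S_policy_def matrix_vector_mult_def if_distrib[of "\<lambda>y. y * _"] cong: if_cong)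

section \<open>Balance and bottlenecks\<close>

text \<open>The inequality is the statement that no backlog decreases, because \<open>r - C_minus N *v f\<close> is the
  derivative of the backlogs.\<close>
definition balanced :: "('p::finite, 'q::finite) petri_net \<Rightarrow> real^'p \<Rightarrow> real^'q \<Rightarrow> bool" where
  "balanced N r f \<longleftrightarrow> (\<forall>q. 0 \<le> f $ q) \<and> C_plus N *v f = r \<and>
     (\<forall>p. (C_minus N *v f) $ p \<le> r $ p) \<and>
     (\<forall>p\<in>P_conflict N. \<forall>q\<in>p_out N p. a_minus N q p * f $ q = weight N q p * r $ p)"

text \<open>The last clause makes the term of \<open>p\<close> in the minimum for the rate of \<open>q_plus N p\<close> equal to that
  rate: this term ignores what \<open>q_minus N p\<close> takes, so a fully consumed place attains the minimum
  only if \<open>q_minus N p\<close> takes nothing.\<close>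
definition bottleneck :: "('p::finite, 'q::finite) petri_net \<Rightarrow> real^'p \<Rightarrow> real^'q \<Rightarrow> 'q \<Rightarrow> 'p \<Rightarrow> bool" where
  "bottleneck N r f q p \<longleftrightarrow> p \<in> q_in N q \<and> (C_minus N *v f) $ p = r $ p \<and>
     (p \<in> P_priority N \<longrightarrow> q = q_plus N p \<longrightarrow> f $ q_minus N p = 0)"

definition equilibrium :: "('p::finite, 'q::finite) petri_net \<Rightarrow> real^'p \<Rightarrow> real^'q \<Rightarrow> bool" where
  "equilibrium N r f \<longleftrightarrow> balanced N r f \<and> (\<forall>q. \<exists>p. bottleneck N r f q p)"

lemma balanced_rate_le:
  assumes "balanced N r f" "p \<in> q_in N q"
  shows "f $ q \<le> r $ p / a_minus N q p"
proof -
  have "a_minus N q p * f $ q \<le> (C_minus N *v f) $ p"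
    using assms by (intro consumption_ge) (auto simp: balanced_def)
  also have "\<dots> \<le> r $ p" using assms by (simp add: balanced_def)
  finally show ?thesis using a_minus_pos[OF assms(2)] by (simp add: field_simps)
qed

section \<open>Routing structure of the net\<close>

context
  fixes N :: "('p::finite, 'q::finite) petri_net"
  assumes net: "free_choice_priority_net N"
begin

lemma hold_pos: "hold N p > 0"
  using net by (simp add: free_choice_priority_net_def)

lemma q_in_nonempty: "q_in N q \<noteq> {}"
  using net by (simp add: free_choice_priority_net_def)

lemma weight_pos: "p \<in> P_conflict N \<Longrightarrow> q \<in> p_out N p \<Longrightarrow> weight N q p > 0"
  using net by (simp add: free_choice_priority_net_def)

lemma sum_weight: "p \<in> P_conflict N \<Longrightarrow> (\<Sum>q\<in>p_out N p. weight N q p) = 1"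
  using net by (simp add: free_choice_priority_net_def)

lemma priority_p_out: "p \<in> P_priority N \<Longrightarrow> p_out N p = {q_plus N p, q_minus N p}"
  using net by (simp add: free_choice_priority_net_def)

lemma q_plus_neq_q_minus: "p \<in> P_priority N \<Longrightarrow> q_plus N p \<noteq> q_minus N p"
  using net by (simp add: free_choice_priority_net_def)

lemma priority_upstream:
  "p \<in> P_priority N \<Longrightarrow> p \<in> q_in N (q_plus N p)"
  "p \<in> P_priority N \<Longrightarrow> p \<in> q_in N (q_minus N p)"
  using priority_p_out[of p] by (auto simp flip: mem_p_out_iff)

lemma priority_unique:
  assumes "p \<in> P_priority N" "p' \<in> P_priority N" "p \<in> q_in N q" "p' \<in> q_in N q"
  shows "p = p'"
proof -
  have "card (q_in N q \<inter> P_priority N) \<le> 1"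
    using net by (simp add: free_choice_priority_net_def)
  then show ?thesis
    using assms by (metis IntI card_le_Suc0_iff_eq finite One_nat_def)
qed

text \<open>Together with the next three lemmas this describes the neighbourhood of a transition: it is
  synchronizing, or its sole upstream place is a conflict place, or it is routed by exactly one
  priority place. All other upstream places feed this transition only.\<close>
lemma ordinary_place_p_out:
  assumes "p \<in> q_in N q" "p \<notin> P_priority N" "p \<notin> P_conflict N"
  shows "p_out N p = {q}"
proof -
  have fc: "free_choice N p"
    using net assms(2) by (auto simp: free_choice_priority_net_def)
  have "q \<in> p_out N p" using assms(1) by (simp add: mem_p_out_iff)
  moreover have "card (p_out N p) \<noteq> 0" using \<open>q \<in> p_out N p\<close> by auto
  moreover have "card (p_out N p) < 2"
    using fc assms by (auto simp: P_conflict_def)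
  ultimately have "card (p_out N p) = 1" by linarith
  then show ?thesis using \<open>q \<in> p_out N p\<close> by (auto simp: card_1_singleton_iff)
qed

lemma sync_upstream:
  assumes "q \<in> Q_sync N" "p \<in> q_in N q"
  shows "p_out N p = {q}" "p \<notin> P_priority N"
proof -
  have c: "card (p_out N p) = 1" using assms by (simp add: Q_sync_def)
  show "p \<notin> P_priority N"
  proof
    assume "p \<in> P_priority N"
    then have "card (p_out N p) = 2"
      by (simp add: priority_p_out q_plus_neq_q_minus)
    with c show False by simp
  qed
  show "p_out N p = {q}"
    using card_1_singletonE[OF c] assms(2) mem_p_out_iff[of q N p] by (metis singletonD)
qed

text \<open>A second priority place upstream is ruled out by uniqueness, and a conflict place would be
  the sole upstream place.\<close>
lemma priority_side_place:
  assumes "p \<in> P_priority N" "p \<in> q_in N q" "r \<in> q_in N q" "r \<noteq> p"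
  shows "p_out N r = {q}" "r \<notin> P_priority N"
proof -
  show *: "r \<notin> P_priority N"
    using priority_unique[OF assms(1) _ assms(2,3)] assms(4) by auto
  have "r \<notin> P_conflict N"
    using conflict_sole_upstream[OF _ assms(3)] assms(2,4) by auto
  then show "p_out N r = {q}" using ordinary_place_p_out[OF assms(3) *] by simp
qed

lemma transition_cases:
  obtains (sync) "q \<in> Q_sync N"
  | (conflict) p where "p \<in> P_conflict N" "p \<in> q_in N q"
  | (plus) p where "p \<in> P_priority N" "q = q_plus N p"
  | (minus) p where "p \<in> P_priority N" "q = q_minus N p"
proof -
  consider (ord) "\<forall>p\<in>q_in N q. p \<notin> P_priority N \<and> p \<notin> P_conflict N"
    | (con) p where "p \<in> P_conflict N" "p \<in> q_in N q"
    | (prio) p where "p \<in> P_priority N" "p \<in> q_in N q"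
    by blast
  then show thesis
  proof cases
    case ord
    then have "\<forall>p\<in>q_in N q. card (p_out N p) = 1"
      by (simp add: ordinary_place_p_out)
    then have "q \<in> Q_sync N" by (simp add: Q_sync_def free_choice_def)
    then show thesis by (rule sync)
  next
    case con then show thesis by (rule conflict)
  next
    case prio
    then have "q = q_plus N p \<or> q = q_minus N p"
      using priority_p_out[of p] mem_p_out_iff[of q N p] by blast
    then show thesis using prio plus minus by blast
  qed
qed

lemma consumption_priority:
  "p \<in> P_priority N \<Longrightarrow> (C_minus N *v f) $ p =
     a_minus N (q_plus N p) p * f $ q_plus N p + a_minus N (q_minus N p) p * f $ q_minus N p"
  using q_plus_neq_q_minus by (simp add: consumption_sum priority_p_out)

lemma consumption_conflict:
  assumes "p \<in> P_conflict N" "\<forall>q\<in>p_out N p. a_minus N q p * f $ q = weight N q p * x"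
  shows "(C_minus N *v f) $ p = x"
  using assms by (simp add: consumption_sum sum_weight flip: sum_distrib_right)

section \<open>Minimum equations in an equilibrium\<close>

lemma balanced_rate_minus_le:
  assumes "balanced N r f" "p \<in> P_priority N"
  shows "f $ q_minus N p \<le>
    (r $ p - a_minus N (q_plus N p) p * f $ q_plus N p) / a_minus N (q_minus N p) p"
proof -
  have "(C_minus N *v f) $ p \<le> r $ p" using assms by (simp add: balanced_def)
  then show ?thesis
    using consumption_priority[OF assms(2)] a_minus_pos[OF priority_upstream(2)[OF assms(2)]]
    by (simp add: field_simps)
qed

lemma bottleneck_sync:
  assumes "bottleneck N r f q p" "q \<in> Q_sync N"
  shows "a_minus N q p * f $ q = r $ p"
  using assms sync_upstream(1)[of q p] by (simp add: bottleneck_def consumption_single)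

lemma bottleneck_side_place:
  assumes "bottleneck N r f q s" "p \<in> P_priority N" "p \<in> q_in N q" "s \<noteq> p"
  shows "a_minus N q s * f $ q = r $ s"
  using assms priority_side_place(1)[of p q s] by (simp add: bottleneck_def consumption_single)

lemma bottleneck_plus:
  assumes "bottleneck N r f (q_plus N p) s" "p \<in> P_priority N"
  shows "a_minus N (q_plus N p) s * f $ q_plus N p = r $ s"
proof (cases "s = p")
  case True
  then show ?thesis
    using assms by (auto simp: bottleneck_def consumption_priority)
next
  case False
  then show ?thesis
    using bottleneck_side_place[OF assms priority_upstream(1)[OF assms(2)]] by simp
qed

lemma bottleneck_minus:
  assumes "bottleneck N r f (q_minus N p) p" "p \<in> P_priority N"
  shows "(r $ p - a_minus N (q_plus N p) p * f $ q_plus N p) / a_minus N (q_minus N p) p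
    = f $ q_minus N p"
  using assms q_plus_neq_q_minus[of p]
  by (simp add: bottleneck_def consumption_priority a_minus_divide_eq)

text \<open>In the following equations the minima range over the upstream places that satisfy a
  predicate \<open>Z\<close>. Taking \<open>Z\<close> always true gives the throughput equations of the discrete dynamics;
  taking the places whose backlog is zero at time \<open>t\<close> gives the equations of the continuous
  dynamics at time \<open>t\<close>.\<close>
context
  fixes r :: "real^'p" and f :: "real^'q" and Z :: "'p \<Rightarrow> bool"
  assumes bal: "balanced N r f" and bot: "\<And>q. \<exists>p. Z p \<and> bottleneck N r f q p"
begin

lemma equilibrium_rate_sync:
  assumes "q \<in> Q_sync N"
  shows "ereal (f $ q) = (INF p\<in>{p \<in> q_in N q. Z p}. ereal (r $ p / a_minus N q p))"
proof -
  obtain p where p: "Z p" "bottleneck N r f q p" using bot by blast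
  then have "p \<in> {p \<in> q_in N q. Z p}" "r $ p / a_minus N q p = f $ q"
    using bottleneck_sync[OF p(2) assms] by (simp_all add: bottleneck_def a_minus_divide_eq)
  then show ?thesis
    using balanced_rate_le[OF bal] by (subst ereal_eq_INF_iff) auto
qed

lemma equilibrium_rate_plus:
  assumes "p \<in> P_priority N"
  shows "ereal (f $ q_plus N p) =
    (INF s\<in>{s \<in> q_in N (q_plus N p). Z s}. ereal (r $ s / a_minus N (q_plus N p) s))"
proof -
  obtain s where s: "Z s" "bottleneck N r f (q_plus N p) s" using bot by blast
  then have "s \<in> {s \<in> q_in N (q_plus N p). Z s}"
    "r $ s / a_minus N (q_plus N p) s = f $ q_plus N p"
    using bottleneck_plus[OF s(2) assms] by (simp_all add: bottleneck_def a_minus_divide_eq)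
  then show ?thesis
    using balanced_rate_le[OF bal] by (subst ereal_eq_INF_iff) auto
qed

lemma side_places_rate_minus_ge:
  "ereal (f $ q_minus N p) \<le>
    (INF s\<in>{s \<in> q_in N (q_minus N p) - {p}. Z s}. ereal (r $ s / a_minus N (q_minus N p) s))"
  using balanced_rate_le[OF bal] by (auto intro!: INF_greatest)

lemma side_places_rate_minus:
  assumes "p \<in> P_priority N" "Z s" "bottleneck N r f (q_minus N p) s" "s \<noteq> p"
  shows "ereal (f $ q_minus N p) =
    (INF s\<in>{s \<in> q_in N (q_minus N p) - {p}. Z s}. ereal (r $ s / a_minus N (q_minus N p) s))"
proof -
  have "s \<in> {s \<in> q_in N (q_minus N p) - {p}. Z s}"
    "r $ s / a_minus N (q_minus N p) s = f $ q_minus N p"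
    using assms(2-4) bottleneck_side_place[OF assms(3,1) priority_upstream(2)[OF assms(1)] assms(4)]
    by (simp_all add: bottleneck_def a_minus_divide_eq)
  then show ?thesis
    using balanced_rate_le[OF bal] by (subst ereal_eq_INF_iff) auto
qed

text \<open>A priority place outside \<open>Z\<close> cannot be the bottleneck in \<open>Z\<close> that is known to exist, so
  another upstream place is.\<close>
lemma equilibrium_rate_minus_idle:
  assumes "p \<in> P_priority N" "\<not> Z p"
  shows "ereal (f $ q_minus N p) =
    (INF s\<in>{s \<in> q_in N (q_minus N p) - {p}. Z s}. ereal (r $ s / a_minus N (q_minus N p) s))"
proof -
  obtain s where "Z s" "bottleneck N r f (q_minus N p) s" using bot by blast
  with assms show ?thesis by (intro side_places_rate_minus) auto
qed

lemma equilibrium_rate_minus: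
  assumes "p \<in> P_priority N"
  shows "ereal (f $ q_minus N p) =
    min (ereal ((r $ p - a_minus N (q_plus N p) p * f $ q_plus N p) / a_minus N (q_minus N p) p))
      (INF s\<in>{s \<in> q_in N (q_minus N p) - {p}. Z s}. ereal (r $ s / a_minus N (q_minus N p) s))"
proof -
  obtain s where s: "Z s" "bottleneck N r f (q_minus N p) s" using bot by blast
  show ?thesis
  proof (cases "s = p")
    case True
    then show ?thesis
      using bottleneck_minus[of r f p] s assms side_places_rate_minus_ge
      by (simp add: min_absorb1)
  next
    case False
    show ?thesis
      unfolding side_places_rate_minus[OF assms s False, symmetric]
      using balanced_rate_minus_le[OF bal assms] by (simp add: min_absorb2)
  qed
qed

end

section \<open>Discrete dynamics\<close>

lemma equilibrium_imp_throughput_eqs: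
  assumes "equilibrium N (\<chi> p. \<rho> $ Inl p) (\<chi> q. \<rho> $ Inr q)"
  shows "throughput_eqs N \<rho>"
proof -
  let ?r = "(\<chi> p. \<rho> $ Inl p) :: real^'p" and ?f = "(\<chi> q. \<rho> $ Inr q) :: real^'q"
  have bal: "balanced N ?r ?f" and bot: "\<And>q. \<exists>p. True \<and> bottleneck N ?r ?f q p"
    using assms by (auto simp: equilibrium_def)
  have "\<rho> $ Inl p = (\<Sum>q\<in>p_in N p. a_plus N q p * \<rho> $ Inr q)" for p
    using production_sum[of N ?f p] bal by (simp add: balanced_def)
  moreover have "\<rho> $ Inr q = weight N q p * \<rho> $ Inl p / a_minus N q p"
    if "p \<in> P_conflict N" "q \<in> p_out N p" for p q
    using bal that a_minus_pos[of p N q] by (simp add: balanced_def mem_p_out_iff field_simps)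
  ultimately show ?thesis
    unfolding throughput_eqs_def Let_def
    using equilibrium_rate_sync[OF bal bot, unfolded simp_thms Collect_mem_eq]
      equilibrium_rate_plus[OF bal bot, unfolded simp_thms Collect_mem_eq]
      equilibrium_rate_minus[OF bal bot, unfolded simp_thms Collect_mem_eq]
    by simp
qed

text \<open>With the initial marking \<open>m\<close>, the numerators \<open>u - \<rho> * hold\<close> of all terms in the constant
  equations vanish. The only way in which these equations could still fail is an empty minimum
  that stands alone on its right-hand side. There the index set contains a bottleneck: at a
  priority place \<open>p\<close>, the minimum stands alone only if \<open>p\<close> itself is not the bottleneck.\<close>
lemma equilibrium_imp_stationary_discrete:
  fixes m :: "real^'p" and f :: "real^'q"
  defines "\<rho> \<equiv> \<chi> i. case i of Inl p \<Rightarrow> m $ p / hold N p | Inr q \<Rightarrow> f $ q"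
    and "u \<equiv> \<chi> i. case i of Inl p \<Rightarrow> m $ p | Inr q \<Rightarrow> 0"
  assumes eq: "equilibrium N (over_hold N m) f" and m: "\<forall>p. 0 \<le> m $ p"
  shows "stationary_discrete N m \<rho> u"
proof -
  have r: "(\<chi> p. \<rho> $ Inl p) = over_hold N m" and f: "(\<chi> q. \<rho> $ Inr q) = f"
    by (simp_all add: vec_eq_iff \<rho>_def over_hold_def)
  have \<rho>p: "\<rho> $ Inl p = over_hold N m $ p" and \<rho>q: "\<rho> $ Inr q = f $ q" for p q
    by (simp_all add: \<rho>_def over_hold_def)
  have u: "m $ p - \<rho> $ Inl p * hold N p = 0" "u $ Inr q = 0" "u $ Inl p = m $ p" for p q
    using hold_pos[of p] by (simp_all add: \<rho>_def u_def)
  have bal: "balanced N (over_hold N m) f"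
    using eq by (simp add: equilibrium_def)
  have nonneg: "\<rho> $ i \<ge> 0" for i
    using m bal hold_pos by (cases i) (simp_all add: \<rho>_def balanced_def less_imp_le)
  \<comment> \<open>The minima over the side places of a priority place: they are \<open>0\<close> or, if empty, \<open>\<infinity>\<close>.\<close>
  let ?B = "\<lambda>p q. INF s\<in>{s \<in> q_in N q - {p}. a_minus N q s * \<rho> $ Inr q = \<rho> $ Inl s}.
              ereal ((u $ Inl s - \<rho> $ Inl s * hold N s) / a_minus N q s)"
  have B_ge: "?B p q \<ge> 0" for p q
    by (rule INF_greatest) (simp add: u)
  have B_eq: "?B p q = 0" if "bottleneck N (over_hold N m) f q s" "p \<in> P_priority N" "p \<in> q_in N q" "s \<noteq> p"
    for p q s
  proof -
    have "s \<in> {s \<in> q_in N q - {p}. a_minus N q s * \<rho> $ Inr q = \<rho> $ Inl s}"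
      using that bottleneck_side_place[OF that] by (simp add: bottleneck_def \<rho>p \<rho>q)
    then show ?thesis by (subst (1) zero_ereal_def, subst eq_commute, subst ereal_eq_INF_iff) (auto simp: u)
  qed
  have sync: "ereal (u $ Inr q) = (INF p\<in>{p \<in> q_in N q. a_minus N q p * \<rho> $ Inr q = \<rho> $ Inl p}.
      ereal ((u $ Inl p - \<rho> $ Inl p * hold N p) / a_minus N q p))" if "q \<in> Q_sync N" for q
  proof -
    obtain p where p: "bottleneck N (over_hold N m) f q p" using eq by (auto simp: equilibrium_def)
    then have "p \<in> {p \<in> q_in N q. a_minus N q p * \<rho> $ Inr q = \<rho> $ Inl p}"
      using bottleneck_sync[OF p that] by (simp add: bottleneck_def \<rho>p \<rho>q)
    then show ?thesis by (subst ereal_eq_INF_iff) (auto simp: u)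
  qed
  have plus: "?B p (q_plus N p) = 0" if "p \<in> P_priority N" "\<rho> $ Inr (q_minus N p) \<noteq> 0" for p
  proof -
    obtain s where s: "bottleneck N (over_hold N m) f (q_plus N p) s"
      using eq by (auto simp: equilibrium_def)
    then have "s \<noteq> p" using that by (auto simp: bottleneck_def \<rho>q)
    then show ?thesis by (rule B_eq[OF s that(1) priority_upstream(1)[OF that(1)]])
  qed
  have minus: "?B p (q_minus N p) = 0"
    if "p \<in> P_priority N" "a_minus N (q_minus N p) p * \<rho> $ Inr (q_minus N p)
      + a_minus N (q_plus N p) p * \<rho> $ Inr (q_plus N p) \<noteq> \<rho> $ Inl p" for p
  proof -
    obtain s where s: "bottleneck N (over_hold N m) f (q_minus N p) s"
      using eq by (auto simp: equilibrium_def)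
    then have "s \<noteq> p"
      using that consumption_priority[of p f] by (auto simp: bottleneck_def \<rho>q \<rho>p)
    then show ?thesis by (rule B_eq[OF s that(1) priority_upstream(2)[OF that(1)]])
  qed
  have "constant_eqs N m \<rho> u"
    unfolding constant_eqs_def Let_def
    using plus minus B_ge sync
    by (simp add: u min_absorb1 flip: zero_ereal_def)
  then show ?thesis
    using equilibrium_imp_throughput_eqs[of \<rho>] eq m nonneg
    by (simp add: stationary_discrete_def r f)
qed

text \<open>The consumption of a place is at most its flow because it is spent by weight at a conflict
  place, by the first term of the minimum for \<open>q_minus N p\<close> at a priority place \<open>p\<close>, and by a
  single transition whose rate is a minimum that involves the place otherwise.\<close>
lemma throughput_eqs_imp_balanced:
  assumes th: "throughput_eqs N \<rho>" and nonneg: "\<And>i. \<rho> $ i \<ge> 0"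
  shows "balanced N (\<chi> p. \<rho> $ Inl p) (\<chi> q. \<rho> $ Inr q)" (is "balanced N ?r ?f")
proof -
  have conflict_eq: "a_minus N q p * ?f $ q = weight N q p * ?r $ p"
    if "p \<in> P_conflict N" "q \<in> p_out N p" for p q
    using th that a_minus_pos[of p N q] by (simp add: throughput_eqs_def mem_p_out_iff)
  have sync_le: "\<rho> $ Inr q \<le> \<rho> $ Inl p / a_minus N q p" if "q \<in> Q_sync N" "p \<in> q_in N q" for p q
    using th that by (auto simp: throughput_eqs_def ereal_eq_INF_iff)
  have plus_le: "\<rho> $ Inr (q_plus N p) \<le> \<rho> $ Inl s / a_minus N (q_plus N p) s"
    if "p \<in> P_priority N" "s \<in> q_in N (q_plus N p)" for p s
    using th that by (auto simp: throughput_eqs_def Let_def ereal_eq_INF_iff)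
  have minus_eq: "ereal (\<rho> $ Inr (q_minus N p)) =
      min (ereal ((\<rho> $ Inl p - a_minus N (q_plus N p) p * \<rho> $ Inr (q_plus N p)) / a_minus N (q_minus N p) p))
        (INF s\<in>q_in N (q_minus N p) - {p}. ereal (\<rho> $ Inl s / a_minus N (q_minus N p) s))"
    if "p \<in> P_priority N" for p
    using th that by (simp add: throughput_eqs_def Let_def)
  have minus_le: "\<rho> $ Inr (q_minus N p) \<le> \<rho> $ Inl s / a_minus N (q_minus N p) s"
    if "p \<in> P_priority N" "s \<in> q_in N (q_minus N p)" "s \<noteq> p" for p s
  proof -
    have "ereal (\<rho> $ Inr (q_minus N p)) \<le>
        (INF s\<in>q_in N (q_minus N p) - {p}. ereal (\<rho> $ Inl s / a_minus N (q_minus N p) s))"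
      by (subst minus_eq) (use that in auto)
    also have "\<dots> \<le> ereal (\<rho> $ Inl s / a_minus N (q_minus N p) s)"
      using that by (intro INF_lower) auto
    finally show ?thesis by simp
  qed
  have slack: "(C_minus N *v ?f) $ p \<le> ?r $ p" for p
  proof -
    consider (none) "p_out N p = {}" | (conflict) "p \<in> P_conflict N" | (priority) "p \<in> P_priority N"
      | (ord) q where "p \<in> q_in N q" "p \<notin> P_conflict N" "p \<notin> P_priority N"
      by (metis all_not_in_conv mem_p_out_iff)
    then show ?thesis
    proof cases
      case none
      then show ?thesis by (simp add: consumption_sum nonneg)
    next
      case conflict
      then show ?thesis
        using consumption_conflict[of p ?f "?r $ p"] conflict_eq by auto
    next
      case priority
      have "ereal (\<rho> $ Inr (q_minus N p)) \<le>
          ereal ((\<rho> $ Inl p - a_minus N (q_plus N p) p * \<rho> $ Inr (q_plus N p)) / a_minus N (q_minus N p) p)"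
        by (subst minus_eq) (use priority in auto)
      then show ?thesis
        using a_minus_pos[OF priority_upstream(2)[OF priority]]
        by (simp add: consumption_priority priority field_simps)
    next
      case ord
      have "\<rho> $ Inr q \<le> \<rho> $ Inl p / a_minus N q p"
      proof (cases rule: transition_cases[of q])
        case sync
        then show ?thesis using sync_le ord by simp
      next
        case (conflict p')
        then show ?thesis using ord conflict_sole_upstream[of p' N q] by auto
      next
        case (plus p')
        then show ?thesis using plus_le ord by simp
      next
        case (minus p')
        then show ?thesis using minus_le[of p' p] ord by auto
      qed
      then show ?thesis
        using ord a_minus_pos[OF ord(1)] consumption_single[OF ordinary_place_p_out[OF ord(1,3,2)]]
        by (simp add: field_simps)
    qed
  qed
  have "C_plus N *v ?f = ?r"
    using th by (simp add: vec_eq_iff production_sum throughput_eqs_def)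
  with slack conflict_eq nonneg show ?thesis by (simp add: balanced_def)
qed

text \<open>A conflict place is a bottleneck of its outputs because its weights sum to \<open>1\<close>, and otherwise
  a place that attains the minimum for a transition is a bottleneck. The latter is not obvious only
  if the minimum for \<open>q_plus N p\<close> is attained at \<open>p\<close> itself; balance at \<open>p\<close> and nonnegativity then
  force \<open>q_minus N p\<close> to be at rest.\<close>
lemma throughput_eqs_imp_equilibrium:
  assumes th: "throughput_eqs N \<rho>" and nonneg: "\<And>i. \<rho> $ i \<ge> 0"
  shows "equilibrium N (\<chi> p. \<rho> $ Inl p) (\<chi> q. \<rho> $ Inr q)" (is "equilibrium N ?r ?f")
proof -
  have bal: "balanced N ?r ?f" using assms by (rule throughput_eqs_imp_balanced)
  have side: "bottleneck N ?r ?f q s"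
    if "p \<in> P_priority N" "p \<in> q_in N q" "s \<in> q_in N q" "s \<noteq> p"
      "\<rho> $ Inl s / a_minus N q s = \<rho> $ Inr q" for p q s
    using priority_side_place[OF that(1-4)] that(3,5)
    by (simp add: bottleneck_def consumption_single a_minus_divide_eq)
  have "\<exists>p. bottleneck N ?r ?f q p" for q
  proof (cases rule: transition_cases[of q])
    case sync
    then obtain p where "p \<in> q_in N q" "\<rho> $ Inl p / a_minus N q p = \<rho> $ Inr q"
      using th by (auto simp: throughput_eqs_def ereal_eq_INF_iff)
    then have "bottleneck N ?r ?f q p"
      using sync_upstream[OF sync] by (simp add: bottleneck_def consumption_single a_minus_divide_eq)
    then show ?thesis by blast
  next
    case (conflict p)
    then have "bottleneck N ?r ?f q p"
      using bal consumption_conflict[of p ?f "?r $ p"] conflict_not_priority[OF conflict(1)]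
      by (auto simp: bottleneck_def balanced_def)
    then show ?thesis by blast
  next
    case (plus p)
    have up: "p \<in> q_in N q" using plus priority_upstream(1) by simp
    obtain s where s: "s \<in> q_in N q" "\<rho> $ Inl s / a_minus N q s = \<rho> $ Inr q"
      using th plus by (auto simp: throughput_eqs_def Let_def ereal_eq_INF_iff)
    show ?thesis
    proof (cases "s = p")
      case True
      have "a_minus N q p * \<rho> $ Inr q = \<rho> $ Inl p"
        using s True by (simp add: a_minus_divide_eq)
      moreover have "a_minus N q p * \<rho> $ Inr q
          + a_minus N (q_minus N p) p * \<rho> $ Inr (q_minus N p) \<le> \<rho> $ Inl p"
        using bal plus consumption_priority[OF plus(1), of ?f]
        by (auto simp: balanced_def dest: spec[of _ p])
      ultimately have "a_minus N (q_minus N p) p * \<rho> $ Inr (q_minus N p) \<le> 0"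
        by linarith
      then have "\<rho> $ Inr (q_minus N p) \<le> 0"
        using a_minus_pos[OF priority_upstream(2)[OF plus(1)]] by (simp add: mult_le_0_iff)
      then have "\<rho> $ Inr (q_minus N p) = 0"
        using nonneg[of "Inr (q_minus N p)"] by simp
      then have "bottleneck N ?r ?f q p"
        using up plus \<open>a_minus N q p * \<rho> $ Inr q = \<rho> $ Inl p\<close>
        by (simp add: bottleneck_def consumption_priority)
      then show ?thesis by blast
    next
      case False
      then show ?thesis using side[OF plus(1) up s(1) _ s(2)] by blast
    qed
  next
    case (minus p)
    have up: "p \<in> q_in N q" using minus priority_upstream(2) by simp
    let ?own = "(\<rho> $ Inl p - a_minus N (q_plus N p) p * \<rho> $ Inr (q_plus N p)) / a_minus N q p"
    let ?others = "INF s\<in>q_in N q - {p}. ereal (\<rho> $ Inl s / a_minus N q s)"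
    have "ereal (\<rho> $ Inr q) = min (ereal ?own) ?others"
      using th minus by (simp add: throughput_eqs_def Let_def)
    then consider "\<rho> $ Inr q = ?own" | "ereal (\<rho> $ Inr q) = ?others"
      by (auto simp: min_def split: if_splits)
    then show ?thesis
    proof cases
      case 1
      then have "?own = \<rho> $ Inr q" by simp
      then have "a_minus N q p * \<rho> $ Inr q = \<rho> $ Inl p - a_minus N (q_plus N p) p * \<rho> $ Inr (q_plus N p)"
        using a_minus_divide_eq[OF up] by blast
      then have "bottleneck N ?r ?f q p"
        using up minus q_plus_neq_q_minus[of p] by (simp add: bottleneck_def consumption_priority)
      then show ?thesis by blast
    next
      case 2
      then obtain s where s: "s \<in> q_in N q" "s \<noteq> p" "\<rho> $ Inl s / a_minus N q s = \<rho> $ Inr q"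
        by (auto simp: ereal_eq_INF_iff)
      then show ?thesis using side[OF minus(1) up s] by blast
    qed
  qed
  with bal show ?thesis by (simp add: equilibrium_def)
qed

section \<open>Continuous dynamics\<close>

text \<open>A rate can be recovered from the consumption of an upstream place that feeds no other
  transition. Such places are missing only for the outputs of conflict places and for transitions
  whose sole upstream place is a priority place. In the latter situation the rate of \<open>q_plus N p\<close>
  has to be known, and the consumption of \<open>p\<close> then determines that of \<open>q_minus N p\<close>.\<close>
lemma flow_eq_if_consumption_eq:
  assumes cons: "\<And>p. (C_minus N *v f) $ p = (C_minus N *v g) $ p"
    and conflict: "\<And>p q. p \<in> P_conflict N \<Longrightarrow> q \<in> p_out N p \<Longrightarrow> f $ q = g $ q"
    and sole: "\<And>p. p \<in> P_priority N \<Longrightarrow> q_in N (q_plus N p) = {p} \<Longrightarrow> f $ q_plus N p = g $ q_plus N p"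
  shows "f = g"
proof -
  have single: "f $ q = g $ q" if "p \<in> q_in N q" "p_out N p = {q}" for p q
    using cons[of p] a_minus_pos[OF that(1)] by (simp add: consumption_single[OF that(2)])
  have plus_eq: "f $ q_plus N p = g $ q_plus N p" if p: "p \<in> P_priority N" for p
  proof (cases "q_in N (q_plus N p) = {p}")
    case False
    then obtain s where s: "s \<in> q_in N (q_plus N p)" "s \<noteq> p"
      using priority_upstream(1)[OF p] by auto
    show ?thesis
      by (rule single[OF s(1) priority_side_place(1)[OF p priority_upstream(1)[OF p] s]])
  qed (use sole p in simp)
  have "f $ q = g $ q" for q
  proof (cases rule: transition_cases[of q])
    case sync
    obtain p where p: "p \<in> q_in N q" using q_in_nonempty[of q] by blast
    show ?thesis by (rule single[OF p sync_upstream(1)[OF sync p]])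
  next
    case (conflict p)
    then show ?thesis using assms(2)[of p q] by (simp add: mem_p_out_iff)
  next
    case (plus p)
    then show ?thesis using plus_eq by simp
  next
    case (minus p)
    then show ?thesis
      using cons[of p] plus_eq[of p] a_minus_pos[OF priority_upstream(2)[of p]]
      by (simp add: consumption_priority)
  qed
  then show ?thesis by (simp add: vec_eq_iff)
qed

text \<open>The set of places with zero backlog may be larger at time \<open>0\<close> than later, so the minimum
  equations do not show directly that the rates at time \<open>0\<close> persist. That the rates are constant
  follows instead from the consumption \<open>r - c\<close>, where \<open>c\<close> are the slopes of the backlogs.\<close>
lemma stationary_continuous_imp_equilibrium:
  assumes "stationary_continuous N m w f"
  shows "equilibrium N (over_hold N (m 0)) (f 0)" "\<forall>t\<ge>0. f t = f 0"
proof -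
  define r where "r = over_hold N (m 0)"
  have sol: "continuous_solution N m w f"
    using assms by (simp add: stationary_continuous_def)
  have m_const: "m t = m 0" if "t \<ge> 0" for t
  proof -
    have "m t $ p = m 0 $ p" for p
    proof -
      obtain k where "\<forall>t\<ge>0. m t $ p = k"
        using assms unfolding stationary_continuous_def by blast
      then show ?thesis using that by simp
    qed
    then show ?thesis by (simp add: vec_eq_iff)
  qed
  have "\<forall>p. \<exists>b c. \<forall>t\<ge>0. w t $ p = b + t * c"
    using assms by (simp add: stationary_continuous_def)
  then obtain b c where w: "\<And>p t. t \<ge> 0 \<Longrightarrow> w t $ p = b p + t * c p"
    by metis
  have w_nonneg: "w t $ p \<ge> 0" if "t \<ge> 0" for t p
    using sol that by (simp add: continuous_solution_def)
  have b_nonneg: "b p \<ge> 0" for p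
    using w[of 0 p] w_nonneg[of 0 p] by simp
  \<comment> \<open>A negative slope would bring the backlog down to \<open>-1\<close> at time \<open>(b p + 1) / (- c p)\<close>.\<close>
  have c_nonneg: "c p \<ge> 0" for p
  proof (rule ccontr)
    assume "\<not> c p \<ge> 0"
    then have "(b p + 1) / (- c p) \<ge> 0" "b p + (b p + 1) / (- c p) * c p = - 1"
      using b_nonneg[of p] by (simp_all add: field_simps)
    then show False
      using w[of "(b p + 1) / (- c p)" p] w_nonneg[of "(b p + 1) / (- c p)" p] by linarith
  qed
  have slack: "(C_minus N *v f t) $ p = r $ p - c p" if "t \<ge> 0" for t p
  proof -
    have "(w has_vector_derivative over_hold N (m t) - C_minus N *v f t) (at t within {0..})"
      using sol that by (simp add: continuous_solution_def)
    then have "(over_hold N (m t) - C_minus N *v f t) $ p = c p"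
      using that w by (intro affine_slope_unique) auto
    then show ?thesis using m_const[OF that] by (simp add: r_def)
  qed
  have prod: "C_plus N *v f 0 = r"
  proof -
    have "(m has_vector_derivative C_plus N *v f 0 - over_hold N (m 0)) (at 0 within {0..})"
      using sol by (simp add: continuous_solution_def)
    moreover have "\<forall>t\<ge>0. m t $ p = m 0 $ p + t * 0" for p
    proof (intro allI impI)
      fix t :: real assume "0 \<le> t"
      then show "m t $ p = m 0 $ p + t * 0" using m_const[of t] by simp
    qed
    ultimately have "(C_plus N *v f 0 - over_hold N (m 0)) $ p = 0" for p
      by (rule affine_slope_unique[OF _ order_refl])
    then show ?thesis by (simp add: r_def vec_eq_iff)
  qed
  have conflict: "a_minus N q p * f t $ q = weight N q p * r $ p"
    if "t \<ge> 0" "p \<in> P_conflict N" "q \<in> p_out N p" for t p q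
    using sol that m_const[OF that(1)] by (simp add: continuous_solution_def r_def over_hold_def)
  have zero: "\<exists>p\<in>q_in N q. w t $ p = 0" if "t \<ge> 0" for t q
    using sol that by (simp add: continuous_solution_def)
  have plus_rate: "\<exists>s\<in>q_in N (q_plus N p). w t $ s = 0 \<and> a_minus N (q_plus N p) s * f t $ q_plus N p = r $ s"
    if "t \<ge> 0" "p \<in> P_priority N" for t p
  proof -
    have "ereal (f t $ q_plus N p) = (INF s\<in>{s \<in> q_in N (q_plus N p). w t $ s = 0}.
        ereal (m t $ s / (a_minus N (q_plus N p) s * hold N s)))"
      using sol that by (simp add: continuous_solution_def Let_def)
    then obtain s where s: "s \<in> q_in N (q_plus N p)" "w t $ s = 0"
        "m t $ s / (a_minus N (q_plus N p) s * hold N s) = f t $ q_plus N p"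
      by (auto simp: ereal_eq_INF_iff)
    then have "a_minus N (q_plus N p) s * f t $ q_plus N p = r $ s"
      using m_const[OF that(1)] a_minus_pos[OF s(1)]
      by (simp add: r_def over_hold_def flip: s(3))
    then show ?thesis using s by blast
  qed
  show const: "\<forall>t\<ge>0. f t = f 0"
  proof (intro allI impI flow_eq_if_consumption_eq)
    fix t :: real and p assume t: "0 \<le> t"
    show "(C_minus N *v f t) $ p = (C_minus N *v f 0) $ p"
      using slack t by simp
    show "f t $ q = f 0 $ q" if "p \<in> P_conflict N" "q \<in> p_out N p" for q
    proof -
      have "a_minus N q p * f t $ q = a_minus N q p * f 0 $ q"
        using conflict[OF t that] conflict[OF order_refl that] by simp
      then show ?thesis using a_minus_pos[of p N q] that by (simp add: mem_p_out_iff)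
    qed
    show "f t $ q_plus N p = f 0 $ q_plus N p"
      if "p \<in> P_priority N" "q_in N (q_plus N p) = {p}"
    proof -
      have "a_minus N (q_plus N p) p * f t $ q_plus N p = a_minus N (q_plus N p) p * f 0 $ q_plus N p"
        using plus_rate[OF t that(1)] plus_rate[OF order_refl that(1)] that(2) by simp
      then show ?thesis using a_minus_pos[OF priority_upstream(1)[OF that(1)]] by simp
    qed
  qed
  have bal: "balanced N r (f 0)"
    using prod slack[of 0] c_nonneg conflict[of 0] sol
    by (simp add: balanced_def continuous_solution_def)
  \<comment> \<open>Time \<open>1\<close> stands for any positive time; at time \<open>0\<close> the backlog may vanish with positive slope.\<close>
  have tight: "(C_minus N *v f 0) $ p = r $ p" if "w 1 $ p = 0" for p
    using w[of 1 p] that b_nonneg[of p] c_nonneg[of p] slack[of 0 p] by simp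
  have "\<exists>p. bottleneck N r (f 0) q p" for q
  proof (cases rule: transition_cases[of q])
    case sync
    then show ?thesis
      using zero[of 1 q] tight sync_upstream(2)[OF sync] by (auto simp: bottleneck_def)
  next
    case (conflict p)
    then show ?thesis
      using zero[of 1 q] tight conflict_sole_upstream[OF conflict] conflict_not_priority[OF conflict(1)]
      by (auto simp: bottleneck_def)
  next
    case (plus p)
    \<comment> \<open>An arbitrary place without backlog would not do: it may be shared with \<open>q_minus N p\<close>.\<close>
    obtain s where s: "s \<in> q_in N q" "w 1 $ s = 0" "a_minus N q s * f 0 $ q = r $ s"
      using plus_rate[of 1 p] const[rule_format, of 1] plus by auto
    have "f 0 $ q_minus N s = 0" if "s \<in> P_priority N" "q = q_plus N s"
      using tight[OF s(2)] s(3) that a_minus_pos[OF priority_upstream(2)[OF that(1)]]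
      by (simp add: consumption_priority)
    then show ?thesis using s tight by (auto simp: bottleneck_def)
  next
    case (minus p)
    obtain s where s: "s \<in> q_in N q" "w 1 $ s = 0" using zero[of 1 q] by auto
    have "q \<noteq> q_plus N s" if "s \<in> P_priority N"
      using priority_unique[OF that minus(1) s(1)] priority_upstream(2)[OF minus(1)]
        q_plus_neq_q_minus[OF that] minus(2) by auto
    then show ?thesis using s tight by (auto simp: bottleneck_def)
  qed
  with bal show "equilibrium N (over_hold N (m 0)) (f 0)" by (simp add: equilibrium_def r_def)
qed

section \<open>Policies\<close>

lemma C_policy_mult:
  "(C_policy N \<pi> *v f) $ q =
    (if \<pi> q \<in> P_conflict N then a_minus N q (\<pi> q) / weight N q (\<pi> q) else a_minus N q (\<pi> q)) * f $ q
    + (if \<pi> q \<in> P_priority N \<and> q = q_minus N (\<pi> q)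
       then a_minus N (q_plus N (\<pi> q)) (\<pi> q) * f $ q_plus N (\<pi> q) else 0)"
proof -
  let ?p = "\<pi> q"
  let ?d = "if ?p \<in> P_conflict N then a_minus N q ?p / weight N q ?p else a_minus N q ?p"
  let ?o = "if ?p \<in> P_priority N \<and> q = q_minus N ?p
    then a_minus N (q_plus N ?p) ?p * f $ q_plus N ?p else 0"
  have "(C_policy N \<pi> *v f) $ q =
      (\<Sum>q'\<in>UNIV. (if q' = q then ?d * f $ q else 0) + (if q' = q_plus N ?p then ?o else 0))"
    unfolding matrix_vector_mult_def C_policy_def Let_def vec_lambda_beta
    using q_plus_neq_q_minus[of ?p] by (intro sum.cong refl) auto
  then show ?thesis by (simp add: sum.distrib)
qed

text \<open>At a bottleneck the entry of \<open>C_policy N \<pi> *v f\<close> is the whole consumption of the place, hence its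
  flow. For \<open>q_plus N p\<close> at a priority place \<open>p\<close> this entry leaves out the share of \<open>q_minus N p\<close>,
  which vanishes by the definition of a bottleneck.\<close>
lemma bottleneck_policy_equation:
  assumes "balanced N r f" "\<And>q. bottleneck N r f q (\<pi> q)"
  shows "(S_policy \<pi> ** C_plus N - C_policy N \<pi>) *v f = 0"
proof -
  have "r $ \<pi> q = (C_policy N \<pi> *v f) $ q" for q
  proof -
    have up: "\<pi> q \<in> q_in N q" and tight: "(C_minus N *v f) $ \<pi> q = r $ \<pi> q"
      using assms(2)[of q] by (simp_all add: bottleneck_def)
    consider (con) "\<pi> q \<in> P_conflict N" | (prio) "\<pi> q \<in> P_priority N"
      | (ord) "\<pi> q \<notin> P_conflict N" "\<pi> q \<notin> P_priority N"
      by blast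
    then show ?thesis
    proof cases
      case con
      have "a_minus N q (\<pi> q) * f $ q = weight N q (\<pi> q) * r $ \<pi> q"
        using assms(1) con up by (simp add: balanced_def mem_p_out_iff)
      then show ?thesis
        using con conflict_not_priority[OF con] weight_pos[OF con, of q] up
        by (simp add: C_policy_mult mem_p_out_iff field_simps)
    next
      case prio
      have not_conflict: "\<pi> q \<notin> P_conflict N"
        using prio conflict_not_priority[of "\<pi> q" N] by blast
      have "q = q_plus N (\<pi> q) \<or> q = q_minus N (\<pi> q)"
        using up priority_p_out[OF prio] mem_p_out_iff[of q N "\<pi> q"] by simp
      then show ?thesis
      proof
        assume q: "q = q_plus N (\<pi> q)"
        then have "q \<noteq> q_minus N (\<pi> q)" using q_plus_neq_q_minus[OF prio] by simp
        moreover note not_conflict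
        moreover have "f $ q_minus N (\<pi> q) = 0"
          using assms(2)[of q] prio q by (simp add: bottleneck_def)
        ultimately show ?thesis
          using tight consumption_priority[OF prio, of f] by (simp add: C_policy_mult flip: q)
      next
        assume q: "q = q_minus N (\<pi> q)"
        moreover note not_conflict
        ultimately show ?thesis
          using tight consumption_priority[OF prio, of f] prio by (simp add: C_policy_mult flip: q)
      qed
    next
      case ord
      then show ?thesis
        using tight consumption_single[OF ordinary_place_p_out[OF up ord(2,1)]]
        by (simp add: C_policy_mult)
    qed
  qed
  then show ?thesis
    using assms(1)
    by (simp add: balanced_def matrix_vector_mult_diff_rdistrib S_policy_mult vec_eq_iff
        flip: matrix_vector_mul_assoc)
qed

lemma bottleneck_policy_backlog:
  assumes "balanced N (over_hold N m) f" "\<And>q. bottleneck N (over_hold N m) f q (\<pi> q)"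
  shows "affine_backlog N \<pi> m f (\<lambda>t. t *\<^sub>R (over_hold N m - C_minus N *v f))"
  unfolding affine_backlog_def
proof (intro conjI allI impI)
  fix p
  show "\<exists>b c. \<forall>t\<ge>0. (t *\<^sub>R (over_hold N m - C_minus N *v f)) $ p = b + t * c"
    by (intro exI[of _ 0] exI[of _ "(over_hold N m - C_minus N *v f) $ p"]) simp
next
  fix t :: real and p assume "0 \<le> t"
  then show "0 \<le> (t *\<^sub>R (over_hold N m - C_minus N *v f)) $ p"
    using assms(1) by (simp add: balanced_def)
next
  fix t :: real
  show "((\<lambda>t. t *\<^sub>R (over_hold N m - C_minus N *v f)) has_vector_derivative
      over_hold N m - C_minus N *v f) (at t within {0..})"
    by (auto intro!: derivative_eq_intros simp: has_vector_derivative_def)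
next
  fix t :: real
  show "S_policy \<pi> *v (t *\<^sub>R (over_hold N m - C_minus N *v f)) = 0"
    using assms(2) by (simp add: vec_eq_iff S_policy_mult bottleneck_def)
qed

lemma affine_backlog_imp_stationary_continuous:
  assumes bal: "balanced N (over_hold N m) f"
    and bot: "\<And>q. bottleneck N (over_hold N m) f q (\<pi> q)"
    and w: "affine_backlog N \<pi> m f w" and m: "\<forall>p. 0 \<le> m $ p"
  shows "stationary_continuous N (\<lambda>t. m) w (\<lambda>t. f)"
proof -
  have affine: "\<exists>b c. \<forall>t\<ge>0. w t $ p = b + t * c" for p
    using w by (simp add: affine_backlog_def)
  have nonneg: "w t $ p \<ge> 0"
    and deriv: "(w has_vector_derivative over_hold N m - C_minus N *v f) (at t within {0..})"
    and zero: "w t $ \<pi> q = 0" if "t \<ge> 0" for t p q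
    using w that S_policy_mult[of \<pi> "w t" q] by (simp_all add: affine_backlog_def)
  have rate: "m $ p / (a_minus N q p * hold N p) = over_hold N m $ p / a_minus N q p" for p q
    by (simp add: over_hold_def)
  have m_deriv: "((\<lambda>t. m) has_vector_derivative C_plus N *v f - over_hold N m) (at t within {0..})" for t
    using bal by (simp add: balanced_def)
  have f_nonneg: "0 \<le> f $ q" for q
    using bal by (simp add: balanced_def)
  have conflict: "a_minus N q p * f $ q = weight N q p * (m $ p / hold N p)"
    if "p \<in> P_conflict N" "q \<in> p_out N p" for p q
    using bal that by (simp add: balanced_def over_hold_def)
  have minus: "over_hold N m $ p / a_minus N (q_minus N p) p
        - a_minus N (q_plus N p) p / a_minus N (q_minus N p) p * f $ q_plus N p
      = (over_hold N m $ p - a_minus N (q_plus N p) p * f $ q_plus N p) / a_minus N (q_minus N p) p" for p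
    by (simp add: diff_divide_distrib)
  have "continuous_solution N (\<lambda>t. m) w (\<lambda>t. f)"
    unfolding continuous_solution_def Let_def
  proof (intro allI impI, goal_cases)
    case (1 t)
    then have t: "0 \<le> t" .
    have "w t $ \<pi> q = 0 \<and> bottleneck N (over_hold N m) f q (\<pi> q)" for q
      using zero[OF t] bot by simp
    then have Z: "\<exists>p. w t $ p = 0 \<and> bottleneck N (over_hold N m) f q p" for q by blast
    have up: "\<exists>p\<in>q_in N q. w t $ p = 0" for q
      using Z[of q] by (auto simp: bottleneck_def)
    note rates = equilibrium_rate_plus[OF bal Z] equilibrium_rate_sync[OF bal Z]
      equilibrium_rate_minus[OF bal Z] equilibrium_rate_minus_idle[OF bal Z]
    show ?case
      unfolding rate minus
      by (intro conjI ballI allI impI;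
          (rule rates conflict m_deriv deriv[OF t] up m[rule_format] nonneg[OF t] f_nonneg;
           assumption?))
  qed
  with affine show ?thesis by (simp add: stationary_continuous_def)
qed

end

section \<open>Correspondence of stationary solutions\<close>

theorem corollary6:
  fixes N :: "('p::finite, 'q::finite) petri_net"
  assumes "free_choice_priority_net N"
  shows "(\<forall>m w f. stationary_continuous N m w f \<longrightarrow>
            (\<forall>t\<ge>0. f t = f 0) \<and>
            stationary_discrete N (m 0)
              (\<chi> i. case i of Inl p \<Rightarrow> m 0 $ p / hold N p | Inr q \<Rightarrow> f 0 $ q)
              (\<chi> i. case i of Inl p \<Rightarrow> m 0 $ p | Inr q \<Rightarrow> 0)) \<and>
         (\<forall>M0 \<rho> u m f. stationary_discrete N M0 \<rho> u \<longrightarrow>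
            f = (\<chi> q. \<rho> $ Inr q) \<longrightarrow> m = (\<chi> p. \<rho> $ Inl p * hold N p) \<longrightarrow>
            (\<exists>\<pi>. is_policy N \<pi> \<and>
               (S_policy \<pi> ** C_plus N - C_policy N \<pi>) *v f = 0 \<and>
               (\<exists>w. affine_backlog N \<pi> m f w) \<and>
               (\<forall>w. affine_backlog N \<pi> m f w \<longrightarrow>
                  stationary_continuous N (\<lambda>t. m) w (\<lambda>t. f))))"
proof (intro conjI allI impI)
  fix m w f
  assume st: "stationary_continuous N m w f"
  note eq = stationary_continuous_imp_equilibrium[OF assms st]
  show "stationary_discrete N (m 0)
      (\<chi> i. case i of Inl p \<Rightarrow> m 0 $ p / hold N p | Inr q \<Rightarrow> f 0 $ q)
      (\<chi> i. case i of Inl p \<Rightarrow> m 0 $ p | Inr q \<Rightarrow> 0)"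
    using st by (intro equilibrium_imp_stationary_discrete[OF assms eq(1)])
      (simp add: stationary_continuous_def continuous_solution_def)
  fix t :: real assume "0 \<le> t"
  then show "f t = f 0" using eq(2) by blast
next
  fix M0 \<rho> u m f
  assume st: "stationary_discrete N M0 \<rho> u" and f: "f = (\<chi> q. \<rho> $ Inr q)"
    and m: "m = (\<chi> p. \<rho> $ Inl p * hold N p)"
  have "hold N p \<noteq> 0" for p using hold_pos[OF assms, of p] by simp
  then have "over_hold N m = (\<chi> p. \<rho> $ Inl p)"
    by (simp add: m over_hold_def vec_eq_iff)
  then have eq: "equilibrium N (over_hold N m) f"
    using throughput_eqs_imp_equilibrium[OF assms, of \<rho>] st f
    by (simp add: stationary_discrete_def)
  have m_nonneg: "\<forall>p. 0 \<le> m $ p"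
    using st hold_pos[OF assms] by (simp add: m stationary_discrete_def less_imp_le)
  from eq have bal: "balanced N (over_hold N m) f"
    and "\<forall>q. \<exists>p. bottleneck N (over_hold N m) f q p"
    by (simp_all add: equilibrium_def)
  then obtain \<pi> where bot: "\<And>q. bottleneck N (over_hold N m) f q (\<pi> q)" by metis
  then have "is_policy N \<pi>" by (simp add: is_policy_def bottleneck_def)
  then show "\<exists>\<pi>. is_policy N \<pi> \<and>
      (S_policy \<pi> ** C_plus N - C_policy N \<pi>) *v f = 0 \<and>
      (\<exists>w. affine_backlog N \<pi> m f w) \<and>
      (\<forall>w. affine_backlog N \<pi> m f w \<longrightarrow> stationary_continuous N (\<lambda>t. m) w (\<lambda>t. f))"
    using bottleneck_policy_equation[OF assms bal bot] bottleneck_policy_backlog[OF assms bal bot]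
      affine_backlog_imp_stationary_continuous[OF assms bal bot _ m_nonneg] by blast
qed

end
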